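(* Let $d\ge 2$, let $A = S\Lambda S^{-1}\in\mathbb{C}^{d\times d}$ be diagonalizable by a known eigenvector basis $S$ (an invertible matrix), with $\Lambda=\mathrm{diag}(\lambda_0,\dots,\lambda_{d-1})$, and assume that the eigenvalues $\lambda_0,\dots,\lambda_{d-1}$ are collision-free. Let $\phi\in\mathbb{C}^d$ depend on all eigenspaces of $A$, and let $x\in\mathbb{C}^d$ be given (known). Put $y := S^*x$, $\psi := S^{-1}\phi$ and $c_k := \overline{y_k}\,\psi_k$. If $c_0,\dots,c_{d-1}$ are collision-free too, then the eigenvalues $\lambda_0,\dots,\lambda_{d-1}$ of $A$ are determined by the samples $\{|\langle x, A^\ell\phi\rangle|\}_{\ell=0}^{2d^2-1}$ up to global phase; that is, if $\lambda'_0,\dots,\lambda'_{d-1}\in\mathbb{C}$ are also collision-free and $A' := S\,\mathrm{diag}(\lambda'_0,\dots,\lambda'_{d-1})S^{-1}$ satisfies $|\langle x, A'^\ell\phi\rangle| = |\langle x,A^\ell\phi\rangle|$ for all $\ell=0,\dots,2d^2-1$, then there is $\theta\in\mathbb{R}$ with $\lambda'_k = e^{i\theta}\lambda_k$ for all $k=0,\dots,d-1$.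
   Context: $\langle\cdot,\cdot\rangle$ is the standard inner product on $\mathbb{C}^d$; $S^*$ is the conjugate transpose. Complex numbers $\mu_0,\dots,\mu_{d-1}$ are collision-free if the $d^2$ products $\mu_j\overline{\mu_k}$, $j,k\in\{0,\dots,d-1\}$, are pairwise distinct (for distinct ordered index pairs). The vector $\phi$ depends on all eigenspaces of $A$ if every coordinate of $S^{-1}\phi$ is non-zero. *)

theory Defs
  imports "HOL-Analysis.Analysis"
begin

text \<open>
  \<open>\<complex>\<^sup>d\<close> is rendered as \<^typ>\<open>complex ^ 'n\<close> with \<open>d = CARD('n)\<close>; the finite index type
  \<open>'n\<close> plays the role of \<open>{0,\<dots>,d-1}\<close>.
\<close>

text \<open>
  The complex standard inner product, conjugate-linear in the first argument, so that
  \<open>\<langle>x, S z\<rangle> = (\<Sum>k. cnj (y k) * z k)\<close> for \<open>y = S\<^sup>* x\<close>.  The library's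
  \<open>x \<bullet> y\<close> on \<^typ>\<open>complex ^ 'n\<close> is the real inner product, the real part of this one.
\<close>
definition cinner :: "complex ^ 'n \<Rightarrow> complex ^ 'n \<Rightarrow> complex" where
  "cinner x y = (\<Sum>i\<in>UNIV. cnj (x $ i) * y $ i)"

definition conj_transpose :: "complex ^ 'n ^ 'm \<Rightarrow> complex ^ 'm ^ 'n" where
  "conj_transpose S = map_matrix cnj (transpose S)"

definition diag_matrix :: "('n \<Rightarrow> 'a::zero) \<Rightarrow> 'a ^ 'n ^ 'n" where
  "diag_matrix \<mu> = (\<chi> i j. if i = j then \<mu> i else 0)"

text \<open>The power operator \<open>^\<close> of the class \<^class>\<open>power\<close> acts componentwise on the type of
  matrices, hence a separate power with respect to \<open>**\<close>.\<close>
primrec matrix_power :: "'a::semiring_1 ^ 'n ^ 'n \<Rightarrow> nat \<Rightarrow> 'a ^ 'n ^ 'n" where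
  "matrix_power A 0 = mat 1"
| "matrix_power A (Suc l) = A ** matrix_power A l"

definition collision_free :: "('n \<Rightarrow> complex) \<Rightarrow> bool" where
  "collision_free \<mu> \<longleftrightarrow> inj (\<lambda>(j, k). \<mu> j * cnj (\<mu> k))"

text \<open>The matrix \<open>A = S \<Lambda> S\<^sup>-\<^sup>1\<close> enters only through its eigenvector basis \<open>S\<close>.\<close>
definition depends_on_all_eigenspaces :: "complex ^ 'n ^ 'n \<Rightarrow> complex ^ 'n \<Rightarrow> bool" where
  "depends_on_all_eigenspaces S \<phi> \<longleftrightarrow> (\<forall>k. (matrix_inv S *v \<phi>) $ k \<noteq> 0)"

end

theory Submission
  imports Defs "HOL-Computational_Algebra.Polynomial"
begin

text \<open>
  Squaring the samples gives the exponential sum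
  \<open>|\<langle>x, A\<^sup>l \<phi>\<rangle>|\<^sup>2 = (\<Sum>j k. c\<^sub>j cnj c\<^sub>k (\<lambda>\<^sub>j cnj \<lambda>\<^sub>k)\<^sup>l)\<close>
  with \<open>d\<^sup>2\<close> distinct nodes and \<open>d\<^sup>2\<close> distinct non-zero weights. Two such sums involve at most
  \<open>2d\<^sup>2\<close> nodes, so \<open>2d\<^sup>2\<close> samples determine the weighted nodes, and since the weights are distinct
  they label the nodes: \<open>\<lambda>\<^sub>j cnj \<lambda>\<^sub>k = \<lambda>'\<^sub>j cnj \<lambda>'\<^sub>k\<close> for all \<open>j, k\<close>.
  These products determine the vector \<open>\<lambda>\<close> up to a global phase.
\<close>

text \<open>Injectivity of the Vandermonde system. A linear combination of the given sums replaces
  \<open>a ^ l\<close> by any polynomial of degree below \<open>card B\<close>; the product of the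
  linear factors at the other nodes isolates \<open>b\<close>.\<close>

lemma power_sums_eq_0_imp_weight_eq_0:
  fixes g :: "'a::field \<Rightarrow> 'a"
  assumes "finite B" and "b \<in> B"
    and sums: "\<And>l. l < card B \<Longrightarrow> (\<Sum>a\<in>B. g a * a ^ l) = 0"
  shows "g b = 0"
proof -
  define p where "p = (\<Prod>a\<in>B - {b}. [:- a, 1:])"
  have poly_p: "poly p a = (\<Prod>x\<in>B - {b}. a - x)" for a
    by (simp add: p_def poly_prod)
  have "degree p = card (B - {b})"
    unfolding p_def by (subst degree_prod_eq_sum_degree) auto
  then have deg: "degree p < card B"
    using \<open>finite B\<close> \<open>b \<in> B\<close> by (metis card_Diff1_less)
  have "(\<Sum>a\<in>B. g a * poly p a) = (\<Sum>a\<in>B. \<Sum>l\<le>degree p. coeff p l * (g a * a ^ l))"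
    by (simp add: poly_altdef sum_distrib_left mult_ac)
  also have "\<dots> = (\<Sum>l\<le>degree p. coeff p l * (\<Sum>a\<in>B. g a * a ^ l))"
    by (subst sum.swap) (simp add: sum_distrib_left)
  also have "\<dots> = 0"
    using deg sums by simp
  finally have "(\<Sum>a\<in>B. g a * poly p a) = 0" .
  moreover have "poly p a = 0" if "a \<in> B - {b}" for a
    using that \<open>finite B\<close> by (auto simp: poly_p)
  ultimately have "g b * poly p b = 0"
    using \<open>finite B\<close> \<open>b \<in> B\<close> by (simp add: sum.remove)
  moreover have "poly p b \<noteq> 0"
    using \<open>finite B\<close> by (auto simp: poly_p)
  ultimately show ?thesis by simp
qed

text \<open>The difference of the two sums is a power sum over the union of both node sets, so all
  its combined coefficients vanish. At the node \<open>z i\<close> this forces some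
  \<open>w j\<close> to cancel \<open>a i\<close>, and injectivity of the weights gives
  \<open>j = i\<close>.\<close>

lemma exponential_sum_nodes_unique:
  fixes a z w :: "'i \<Rightarrow> 'a::field"
  assumes fin: "finite I" and inj: "inj_on z I" "inj_on w I" "inj_on a I"
    and nz: "\<And>i. i \<in> I \<Longrightarrow> a i \<noteq> 0"
    and sums: "\<And>l. l < 2 * card I \<Longrightarrow> (\<Sum>i\<in>I. a i * z i ^ l) = (\<Sum>i\<in>I. a i * w i ^ l)"
    and "i \<in> I"
  shows "z i = w i"
proof -
  define B where "B = z ` I \<union> w ` I"
  \<comment> \<open>Summing over fibres covers nodes lying in one image or in both: an empty fibre
    contributes 0.\<close>
  define g where "g b = sum a {i \<in> I. z i = b} - sum a {i \<in> I. w i = b}" for b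
  have finB: "finite B" using fin by (simp add: B_def)
  have cardB: "card B \<le> 2 * card I"
    using card_Un_le[of "z ` I" "w ` I"] card_image_le[OF fin, of z] card_image_le[OF fin, of w]
    by (simp add: B_def)
  have collect: "(\<Sum>b\<in>B. sum a {i \<in> I. v i = b} * b ^ l) = (\<Sum>i\<in>I. a i * v i ^ l)"
    if "v ` I \<subseteq> B" for v l
  proof -
    have "(\<Sum>b\<in>B. sum a {i \<in> I. v i = b} * b ^ l)
        = (\<Sum>b\<in>B. \<Sum>i\<in>{i \<in> I. v i = b}. a i * v i ^ l)"
      by (simp add: sum_distrib_right)
    also have "\<dots> = (\<Sum>i\<in>I. a i * v i ^ l)"
      using fin finB that by (rule sum.group)
    finally show ?thesis .
  qed
  have "(\<Sum>b\<in>B. g b * b ^ l) = 0" if "l < card B" for l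
    using collect[of z l] collect[of w l] sums[of l] that cardB
    by (simp add: g_def left_diff_distrib sum_subtractf B_def)
  moreover have "z i \<in> B" using \<open>i \<in> I\<close> by (simp add: B_def)
  ultimately have "g (z i) = 0"
    using power_sums_eq_0_imp_weight_eq_0[OF finB] by blast
  moreover have "{j \<in> I. z j = z i} = {i}"
    using inj(1) \<open>i \<in> I\<close> by (auto dest: inj_onD)
  ultimately have a_i: "a i = sum a {j \<in> I. w j = z i}"
    by (simp add: g_def)
  \<comment> \<open>Without such a \<open>j\<close> the right-hand sum is empty, which contradicts
    \<open>a i \<noteq> 0\<close>.\<close>
  then obtain j where j: "j \<in> I" "w j = z i"
    using nz[OF \<open>i \<in> I\<close>] by (metis (mono_tags, lifting) mem_Collect_eq sum.neutral)
  then have "{j \<in> I. w j = z i} = {j}"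
    using inj(2) by (auto simp: inj_on_def)
  with a_i have "a i = a j" by simp
  then show ?thesis
    using inj(3) \<open>i \<in> I\<close> j by (metis inj_onD)
qed

text \<open>If \<open>\<mu> k\<close> vanished, the pairs \<open>(j, k)\<close> and
  \<open>(k, j)\<close> would both give the product 0; a second index \<open>j\<close> exists since
  the dimension is at least 2.\<close>

lemma collision_free_nonzero:
  fixes \<mu> :: "'n::finite \<Rightarrow> complex"
  assumes "CARD('n) \<ge> 2" and "collision_free \<mu>"
  shows "\<mu> k \<noteq> 0"
proof
  assume "\<mu> k = 0"
  obtain j where "j \<noteq> k"
    using assms(1) by (metis (full_types) UNIV_I card_2_iff' card_le_Suc0_iff_eq finite
        not_less_eq_eq numeral_2_eq_2)
  then show False
    using assms(2) \<open>\<mu> k = 0\<close> injD[of "\<lambda>(j, k). \<mu> j * cnj (\<mu> k)" "(j, k)" "(k, j)"]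
    by (simp add: collision_free_def)
qed

lemma matrix_inv_mult:
  assumes "invertible S"
  shows "S ** matrix_inv S = mat 1" "matrix_inv S ** S = mat 1"
  using someI_ex[OF assms[unfolded invertible_def]] by (simp_all add: matrix_inv_def)

lemma matrix_power_conjugate:
  fixes S :: "'a::semiring_1 ^ 'n ^ 'n"
  assumes "invertible S"
  shows "matrix_power (S ** D ** matrix_inv S) l = S ** matrix_power D l ** matrix_inv S"
proof (induction l)
  case 0
  show ?case using assms by (simp add: matrix_inv_mult)
next
  case (Suc l)
  have "matrix_power (S ** D ** matrix_inv S) (Suc l)
      = S ** D ** (matrix_inv S ** S) ** matrix_power D l ** matrix_inv S"
    by (simp add: Suc matrix_mul_assoc)
  then show ?case
    using assms by (simp add: matrix_inv_mult matrix_mul_assoc)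
qed

lemma diag_matrix_power_mult_vec:
  fixes v :: "'a::comm_semiring_1 ^ 'n"
  shows "(matrix_power (diag_matrix \<mu>) l *v v) $ k = \<mu> k ^ l * v $ k"
proof (induction l arbitrary: k)
  case 0
  show ?case by simp
next
  case (Suc l)
  have "(diag_matrix \<mu> *v u) $ k = \<mu> k * u $ k" for u :: "'a ^ 'n"
    by (simp add: diag_matrix_def matrix_vector_mult_def if_distrib[where f = "\<lambda>x. x * _"]
        cong: if_cong)
  then show ?case
    by (simp add: Suc matrix_vector_mul_assoc[symmetric] mult.assoc)
qed

lemma cinner_mult_vec:
  "cinner x (S *v v) = cinner (conj_transpose S *v x) v"
proof -
  have "cinner x (S *v v) = (\<Sum>i\<in>UNIV. \<Sum>k\<in>UNIV. cnj (x $ i) * S $ i $ k * v $ k)"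
    by (simp add: cinner_def matrix_vector_mult_def sum_distrib_left mult.assoc)
  also have "\<dots> = cinner (conj_transpose S *v x) v"
    by (subst sum.swap) (simp add: cinner_def conj_transpose_def map_matrix_def transpose_def
        matrix_vector_mult_def sum_distrib_left mult_ac)
  finally show ?thesis .
qed

lemma sample_exponential_sum:
  fixes S :: "complex ^ 'n ^ 'n"
  assumes "invertible S"
  shows "cinner x (matrix_power (S ** diag_matrix \<mu> ** matrix_inv S) l *v \<phi>)
    = (\<Sum>k\<in>UNIV. cnj ((conj_transpose S *v x) $ k) * (matrix_inv S *v \<phi>) $ k * \<mu> k ^ l)"
  by (simp only: matrix_power_conjugate[OF assms] matrix_vector_mul_assoc[symmetric]
      cinner_mult_vec[of x S])
     (simp add: cinner_def diag_matrix_power_mult_vec mult_ac)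

lemma norm_exponential_sum_squared:
  fixes c \<mu> :: "'n::finite \<Rightarrow> complex"
  shows "of_real ((norm (\<Sum>k\<in>UNIV. c k * \<mu> k ^ l))\<^sup>2)
    = (\<Sum>(j, k)\<in>UNIV. (c j * cnj (c k)) * (\<mu> j * cnj (\<mu> k)) ^ l)"
  by (simp only: complex_norm_square cnj_sum sum_product UNIV_Times_UNIV[symmetric]
      sum.cartesian_product[symmetric])
     (simp add: power_mult_distrib mult_ac)

text \<open>The phase is read off at one fixed index: the diagonal product there makes the quotient
  unimodular, and products with that index carry it to all others.\<close>

lemma eq_up_to_global_phase:
  fixes u v :: "'n \<Rightarrow> complex"
  assumes prods: "\<And>j k. u j * cnj (u k) = v j * cnj (v k)" and nz: "\<And>k. u k \<noteq> 0"
  shows "\<exists>\<theta>::real. \<forall>k. v k = exp (\<i> * of_real \<theta>) * u k"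
proof -
  fix k0 :: 'n
  define r where "r = v k0 / u k0"
  have "(norm (u k0))\<^sup>2 = (norm (v k0))\<^sup>2"
    using prods[of k0 k0] by (metis complex_norm_square of_real_eq_iff)
  then have nv: "norm (v k0) = norm (u k0)" by simp
  then have "norm r = 1"
    using nz[of k0] by (simp add: r_def norm_divide)
  then have r: "r = exp (\<i> * of_real (Arg r))"
    using Arg_eq[of r] by force
  have "v k0 \<noteq> 0" using nv nz[of k0] by auto
  have "v k = r * u k" for k
  proof -
    \<comment> \<open>The factor \<open>u k0 / u k0\<close> is inserted so that \<open>prods\<close>
      can turn \<open>u k0 * cnj (u k0)\<close> into \<open>v k0 * cnj (v k0)\<close>, leaving the
      quotient \<open>r\<close>.\<close>
    have "v k * cnj (v k0) = u k * (u k0 * cnj (u k0)) / u k0"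
      using nz[of k0] by (simp add: prods[symmetric])
    also have "\<dots> = (r * u k) * cnj (v k0)"
      by (simp only: prods) (simp add: r_def)
    finally have "v k * cnj (v k0) = (r * u k) * cnj (v k0)" .
    then show ?thesis using \<open>v k0 \<noteq> 0\<close> by simp
  qed
  then show ?thesis using r by metis
qed

theorem theorem5p1:
  fixes S A A' :: "complex ^ 'n ^ 'n"
    and lam lam' c :: "'n \<Rightarrow> complex"
    and \<phi> x y \<psi> :: "complex ^ 'n"
  assumes "CARD('n) \<ge> 2"
    and "invertible S"
    and "A = S ** diag_matrix lam ** matrix_inv S"
    and "collision_free lam"
    and "depends_on_all_eigenspaces S \<phi>"
    and "y = conj_transpose S *v x"
    and "\<psi> = matrix_inv S *v \<phi>"
    and "c = (\<lambda>k. cnj (y $ k) * \<psi> $ k)"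
    and "collision_free c"
    and "collision_free lam'"
    and "A' = S ** diag_matrix lam' ** matrix_inv S"
    and "\<forall>l \<in> {0..2 * CARD('n)^2 - 1}.
           norm (cinner x (matrix_power A' l *v \<phi>)) = norm (cinner x (matrix_power A l *v \<phi>))"
  shows "\<exists>\<theta>::real. \<forall>k. lam' k = exp (\<i> * of_real \<theta>) * lam k"
proof -
  let ?w = "\<lambda>(j, k). c j * cnj (c k)"
  let ?z = "\<lambda>(j, k). lam j * cnj (lam k)"
  let ?z' = "\<lambda>(j, k). lam' j * cnj (lam' k)"
  have sample: "cinner x (matrix_power A l *v \<phi>) = (\<Sum>k\<in>UNIV. c k * lam k ^ l)"
    and sample': "cinner x (matrix_power A' l *v \<phi>) = (\<Sum>k\<in>UNIV. c k * lam' k ^ l)" for l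
    using assms by (simp_all add: sample_exponential_sum)
  \<comment> \<open>The index set is now the set of pairs, of cardinality d^2, so the bound
    \<open>2 * card I\<close> is exactly the number of samples.\<close>
  have "(\<Sum>p\<in>UNIV. ?w p * ?z p ^ l) = (\<Sum>p\<in>UNIV. ?w p * ?z' p ^ l)"
    if "l < 2 * card (UNIV :: ('n \<times> 'n) set)" for l
  proof -
    have "l \<in> {0..2 * CARD('n)^2 - 1}"
      using that by (auto simp: power2_eq_square)
    with assms(12) have "norm (\<Sum>k\<in>UNIV. c k * lam k ^ l) = norm (\<Sum>k\<in>UNIV. c k * lam' k ^ l)"
      by (simp add: sample sample')
    then show ?thesis
      using norm_exponential_sum_squared[of c lam l] norm_exponential_sum_squared[of c lam' l]
      by (simp add: case_prod_unfold)
  qed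
  moreover have "?w p \<noteq> 0" for p
    using collision_free_nonzero[OF assms(1,9)] by (simp add: case_prod_unfold)
  moreover have "inj ?w" "inj ?z" "inj ?z'"
    using assms by (simp_all add: collision_free_def)
  ultimately have nodes: "?z p = ?z' p" for p
    by (intro exponential_sum_nodes_unique[of UNIV ?z ?z' ?w p] finite UNIV_I)
  have "lam j * cnj (lam k) = lam' j * cnj (lam' k)" for j k
    using nodes[of "(j, k)"] by simp
  then show ?thesis
    by (rule eq_up_to_global_phase) (rule collision_free_nonzero[OF assms(1,4)])
qed

end
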